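(* Let $n$ be a positive integer. Then $$t(1,1,8;n)-\frac 12N(1,1,8;8n+10)=t(1,1,8;n)-\frac 13r_3(4n+5)=\begin{cases}2(-1)^{\frac{m+1}2}m&\text{if }4n+5=m^2\text{ for some positive integer }m,\\0&\text{otherwise.}\end{cases}$$
   Context: For positive integers $a_1,\dots,a_k$ and a nonnegative integer $n$, $N(a_1,\dots,a_k;n)$ is the number of $(x_1,\dots,x_k)\in\mathbb Z^k$ with $n=a_1x_1^2+\cdots+a_kx_k^2$, and $t(a_1,\dots,a_k;n)$ is the number of $(x_1,\dots,x_k)\in\mathbb Z^k$ with $n=a_1\frac{x_1(x_1-1)}2+\cdots+a_k\frac{x_k(x_k-1)}2$. Also $r_3(n)=N(1,1,1;n)$. *)

theory Defs
  imports Complex_Main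
begin

text \<open>The coefficient list is meant to consist of positive integers; the solution sets below are then
  finite, so that \<^const>\<open>card\<close> is a genuine count.\<close>

definition N_rep :: "nat list \<Rightarrow> nat \<Rightarrow> nat" where
  "N_rep as n = card {xs :: int list. length xs = length as \<and>
     int n = (\<Sum>i<length as. int (as ! i) * (xs ! i)\<^sup>2)}"

text \<open>The division by 2 is exact, since \<open>x (x - 1)\<close> is even for every integer \<open>x\<close>.\<close>

definition t_rep :: "nat list \<Rightarrow> nat \<Rightarrow> nat" where
  "t_rep as n = card {xs :: int list. length xs = length as \<and>
     int n = (\<Sum>i<length as. int (as ! i) * (xs ! i * (xs ! i - 1) div 2))}"

definition r3 :: "nat \<Rightarrow> nat" where
  "r3 n = N_rep [1, 1, 1] n"

end

theory Submission
  imports Defs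
begin

text \<open>Write \<open>\<chi>\<close> for the nontrivial character modulo 4 (\<open>chi4\<close>). Elementary substitutions turn the
  difference in question into \<open>- b(4n+5)\<close>, where \<open>b(k)\<close> (\<open>oee_sum\<close>) is the sum of \<open>(-1)^(z/2)\<close> over
  \<open>u\<^sup>2 + y\<^sup>2 + z\<^sup>2 = k\<close> with \<open>u\<close> odd and \<open>y\<close>, \<open>z\<close> even. It remains to show \<open>b(k) = a(k)\<close>, where \<open>a(k)\<close>
  (\<open>root_sum\<close>) is the sum of \<open>\<chi>(m) m\<close> over odd \<open>m\<close> with \<open>m\<^sup>2 = k\<close>; this is Jacobi's formula
  \<open>\<theta>\<^sub>1' = \<theta>\<^sub>2 \<theta>\<^sub>3 \<theta>\<^sub>4\<close>. As \<open>a(1) = b(1)\<close>, it suffices that the sum of \<open>a(j) b(l-j) (2j-l)\<close> over \<open>j\<close> vanishes for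
  every \<open>l\<close> (equality of logarithmic derivatives). That sum runs over the vectors \<open>(m, u, y, z)\<close> of
  norm \<open>l\<close> with \<open>m\<close>, \<open>u\<close> odd and \<open>y\<close>, \<open>z\<close> even, weighted by \<open>\<chi>(m + z)\<close> times the harmonic cubic
  \<open>m (m\<^sup>2 - u\<^sup>2 - y\<^sup>2 - z\<^sup>2)\<close>. The isometry given by half the Hadamard matrix preserves \<open>m + z\<close>, hence the
  weight, and comparing \<open>m\<^sup>3\<close> with its image \<open>((m + u + y + z)/2)\<^sup>3\<close> yields the vanishing.\<close>

section \<open>Representation sets and the character modulo 4\<close>

definition chi4 :: "int \<Rightarrow> int" where
  "chi4 k = (if k mod 4 = 1 then 1 else if k mod 4 = 3 then -1 else 0)"

definition odd_roots :: "int \<Rightarrow> int set" where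
  "odd_roots k = {m. odd m \<and> m\<^sup>2 = k}"

definition oee_reps :: "int \<Rightarrow> (int \<times> int \<times> int) set" where
  "oee_reps k = {(u, y, z). odd u \<and> even y \<and> even z \<and> u\<^sup>2 + y\<^sup>2 + z\<^sup>2 = k}"

definition ooee_reps :: "int \<Rightarrow> (int \<times> int \<times> int \<times> int) set" where
  "ooee_reps l = {(m, u, y, z). odd m \<and> odd u \<and> even y \<and> even z \<and> m\<^sup>2 + u\<^sup>2 + y\<^sup>2 + z\<^sup>2 = l}"

definition root_sum :: "int \<Rightarrow> int" where
  "root_sum k = (\<Sum>m\<in>odd_roots k. chi4 m * m)"

definition oee_sum :: "int \<Rightarrow> int" where
  "oee_sum k = (\<Sum>(u, y, z)\<in>oee_reps k. if 4 dvd z then 1 else -1)"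

lemma abs_le_of_square_le:
  fixes x k :: int
  assumes "x\<^sup>2 \<le> k"
  shows "x \<in> {-k..k}"
proof -
  have "\<bar>x\<bar> \<le> \<bar>x\<bar> * \<bar>x\<bar>"
    using mult_left_mono[of 1 "\<bar>x\<bar>" "\<bar>x\<bar>"] by (cases "x = 0") simp_all
  then show ?thesis
    using assms by (simp add: power2_eq_square abs_le_iff flip: abs_mult)
qed

lemma finite_oee_reps [simp]: "finite (oee_reps k)"
proof (rule finite_subset)
  show "oee_reps k \<subseteq> {-k..k} \<times> {-k..k} \<times> {-k..k}"
    unfolding oee_reps_def
  proof safe
    fix u y z :: int
    have "0 \<le> u\<^sup>2" "0 \<le> y\<^sup>2" "0 \<le> z\<^sup>2" by simp_all
    then show "u \<in> {- (u\<^sup>2 + y\<^sup>2 + z\<^sup>2)..u\<^sup>2 + y\<^sup>2 + z\<^sup>2}"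
      and "y \<in> {- (u\<^sup>2 + y\<^sup>2 + z\<^sup>2)..u\<^sup>2 + y\<^sup>2 + z\<^sup>2}"
      and "z \<in> {- (u\<^sup>2 + y\<^sup>2 + z\<^sup>2)..u\<^sup>2 + y\<^sup>2 + z\<^sup>2}"
      by (intro abs_le_of_square_le; linarith)+
  qed
qed simp

lemma finite_odd_roots [simp]: "finite (odd_roots k)"
proof (rule finite_subset)
  show "odd_roots k \<subseteq> {-k..k}"
    unfolding odd_roots_def using abs_le_of_square_le by blast
qed simp

text \<open>Serves twice: for the finiteness of \<open>ooee_reps l\<close>, and for reading a sum
  over it as a convolution of sums over \<open>odd_roots\<close> and
  \<open>oee_reps\<close>.\<close>

lemma ooee_reps_fiber:
  "{v \<in> ooee_reps l. (fst v)\<^sup>2 = k} = odd_roots k \<times> oee_reps (l - k)"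
  by (auto simp: ooee_reps_def odd_roots_def oee_reps_def)

lemma fst_square_ooee_reps: "(\<lambda>v. (fst v)\<^sup>2) ` ooee_reps l \<subseteq> {0..l}"
proof safe
  fix m u y z assume "(m, u, y, z) \<in> ooee_reps l"
  then have "m\<^sup>2 + u\<^sup>2 + y\<^sup>2 + z\<^sup>2 = l" by (simp add: ooee_reps_def)
  moreover have "0 \<le> m\<^sup>2" "0 \<le> u\<^sup>2" "0 \<le> y\<^sup>2" "0 \<le> z\<^sup>2" by simp_all
  ultimately show "(fst (m, u, y, z))\<^sup>2 \<in> {0..l}"
    unfolding fst_conv atLeastAtMost_iff by linarith
qed

lemma finite_ooee_reps [simp]: "finite (ooee_reps l)"
proof -
  have "ooee_reps l = (\<Union>k\<in>{0..l}. {v \<in> ooee_reps l. (fst v)\<^sup>2 = k})"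
    using fst_square_ooee_reps[of l] by blast
  also have "finite \<dots>"
    unfolding ooee_reps_fiber by simp
  finally show ?thesis .
qed

text \<open>A shift by 2 modulo 4 swaps the residues 1 and 3. This merges the character in
  \<open>root_sum\<close> and the sign in \<open>oee_sum\<close> into a single weight.\<close>

lemma chi4_add_even:
  assumes "odd m" "even z"
  shows "chi4 (m + z) = chi4 m * (if 4 dvd z then 1 else -1)"
proof -
  have "m mod 4 = 1 \<or> m mod 4 = 3" using assms(1) by presburger
  moreover have "(m + z) mod 4 = (if 4 dvd z then m mod 4 else 4 - m mod 4)"
    using assms by presburger
  ultimately show ?thesis unfolding chi4_def by auto
qed

lemma chi4_cong: "a mod 4 = b mod 4 \<Longrightarrow> chi4 a = chi4 b"
  by (simp add: chi4_def)

lemma chi4_minus_even: "even z \<Longrightarrow> chi4 (m - z) = chi4 (m + z)"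
  by (rule chi4_cong) presburger

section \<open>Sums twisted by \<open>chi4 (m + z)\<close> and their sign symmetries\<close>

definition twisted_sum :: "int \<Rightarrow> (int \<Rightarrow> int \<Rightarrow> int \<Rightarrow> int \<Rightarrow> int) \<Rightarrow> int" where
  "twisted_sum l f = (\<Sum>(m, u, y, z)\<in>ooee_reps l. chi4 (m + z) * f m u y z)"

lemma twisted_sum_add:
  "twisted_sum l (\<lambda>m u y z. f m u y z + g m u y z) = twisted_sum l f + twisted_sum l g"
  unfolding twisted_sum_def
  by (simp add: sum.distrib case_prod_unfold distrib_left)

lemma twisted_sum_scale: "twisted_sum l (\<lambda>m u y z. c * f m u y z) = c * twisted_sum l f"
  unfolding twisted_sum_def
  by (simp add: sum_distrib_left case_prod_unfold mult.left_commute)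

lemma twisted_sum_flip_u: "twisted_sum l (\<lambda>m u y z. f m (-u) y z) = twisted_sum l f"
  unfolding twisted_sum_def
  by (rule sum.reindex_bij_witness
      [where i = "\<lambda>(m, u, y, z). (m, -u, y, z)" and j = "\<lambda>(m, u, y, z). (m, -u, y, z)"])
    (auto simp: ooee_reps_def)

lemma twisted_sum_flip_y: "twisted_sum l (\<lambda>m u y z. f m u (-y) z) = twisted_sum l f"
  unfolding twisted_sum_def
  by (rule sum.reindex_bij_witness
      [where i = "\<lambda>(m, u, y, z). (m, u, -y, z)" and j = "\<lambda>(m, u, y, z). (m, u, -y, z)"])
    (auto simp: ooee_reps_def)

text \<open>The argument of the weight moves by \<open>2 * z\<close>, a multiple of 4 because
  \<open>z\<close> is even.\<close>

lemma twisted_sum_flip_z: "twisted_sum l (\<lambda>m u y z. f m u y (-z)) = twisted_sum l f"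
  unfolding twisted_sum_def
  by (rule sum.reindex_bij_witness
      [where i = "\<lambda>(m, u, y, z). (m, u, y, -z)" and j = "\<lambda>(m, u, y, z). (m, u, y, -z)"])
    (auto simp: ooee_reps_def chi4_minus_even)

text \<open>Averaging over the eight sign patterns of \<open>(u, y, z)\<close> kills every monomial
  of the cube that is odd in one of these variables.\<close>

lemma twisted_sum_cube:
  "twisted_sum l (\<lambda>m u y z. (m + u + y + z) ^ 3)
     = twisted_sum l (\<lambda>m u y z. m ^ 3) + 3 * twisted_sum l (\<lambda>m u y z. m * (u\<^sup>2 + y\<^sup>2 + z\<^sup>2))"
proof -
  define f :: "int \<Rightarrow> int \<Rightarrow> int \<Rightarrow> int \<Rightarrow> int" where "f m u y z = (m + u + y + z) ^ 3" for m u y z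
  \<comment> \<open>\<open>g\<close> collects both signs of \<open>u\<close>, \<open>h\<close> also
    those of \<open>y\<close>; the signs of \<open>z\<close> are added below, which makes eight
    terms.\<close>
  define g where "g m u y z = f m u y z + f m (-u) y z" for m u y z
  define h where "h m u y z = g m u y z + g m u (-y) z" for m u y z
  have "8 * twisted_sum l f = 4 * twisted_sum l g"
    unfolding g_def twisted_sum_add twisted_sum_flip_u by simp
  also have "4 * twisted_sum l g = 2 * twisted_sum l h"
    unfolding h_def twisted_sum_add twisted_sum_flip_y by simp
  also have "\<dots> = twisted_sum l (\<lambda>m u y z. h m u y z + h m u y (-z))"
    unfolding twisted_sum_add twisted_sum_flip_z by simp
  also have "(\<lambda>m u y z. h m u y z + h m u y (-z))
      = (\<lambda>m u y z. 8 * m ^ 3 + 24 * (m * (u\<^sup>2 + y\<^sup>2 + z\<^sup>2)))"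
    unfolding h_def g_def f_def
    by (intro ext) (simp add: power2_eq_square power3_eq_cube algebra_simps)
  also have "twisted_sum l \<dots> = 8 * twisted_sum l (\<lambda>m u y z. m ^ 3)
      + 24 * twisted_sum l (\<lambda>m u y z. m * (u\<^sup>2 + y\<^sup>2 + z\<^sup>2))"
    by (simp only: twisted_sum_add twisted_sum_scale)
  finally show ?thesis unfolding f_def by simp
qed

definition half_sum :: "int \<Rightarrow> int \<Rightarrow> int \<Rightarrow> int \<Rightarrow> int" where
  "half_sum m u y z = (m + u + y + z) div 2"

lemma two_half_sum:
  assumes "odd m" "odd u" "even y" "even z"
  shows "2 * half_sum m u y z = m + u + y + z"
  using assms unfolding half_sum_def by simp

text \<open>Flipping the sign of \<open>u\<close> preserves the summand and reverses the parity of the half sum.\<close>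

lemma twisted_sum_restrict_odd:
  "2 * twisted_sum l (\<lambda>m u y z. if odd (half_sum m u y z) then m ^ 3 else 0)
     = twisted_sum l (\<lambda>m u y z. m ^ 3)"
proof -
  let ?f = "\<lambda>m u y z. if odd (half_sum m u y z) then m ^ 3 else 0"
  have "2 * twisted_sum l ?f = twisted_sum l (\<lambda>m u y z. ?f m u y z + ?f m (-u) y z)"
    unfolding twisted_sum_add twisted_sum_flip_u[of l ?f] by simp
  also have "\<dots> = twisted_sum l (\<lambda>m u y z. m ^ 3)"
    unfolding twisted_sum_def
  proof (rule sum.cong[OF refl], safe)
    fix m u y z assume "(m, u, y, z) \<in> ooee_reps l"
    then have par: "odd m" "odd u" "even y" "even z" by (auto simp: ooee_reps_def)
    have "half_sum m u y z = half_sum m (-u) y z + u"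
      using two_half_sum[of m u y z] two_half_sum[of m "-u" y z] par by simp
    then have "odd (half_sum m (-u) y z) \<longleftrightarrow> even (half_sum m u y z)"
      using par by simp
    then show "chi4 (m + z) * (?f m u y z + ?f m (-u) y z) = chi4 (m + z) * m ^ 3"
      by simp
  qed
  finally show ?thesis .
qed

section \<open>The Hadamard isometry and the harmonic sum\<close>

text \<open>Half the symmetric Hadamard matrix of order 4, which is orthogonal and its own inverse.
  The four numerators have the same parity, so evenness of the first makes every division
  exact.\<close>

definition hadamard :: "int \<times> int \<times> int \<times> int \<Rightarrow> int \<times> int \<times> int \<times> int" where
  "hadamard = (\<lambda>(m, u, y, z). ((m + u + y + z) div 2, (m + u - y - z) div 2,
     (m - u + y - z) div 2, (m - u - y + z) div 2))"

lemma hadamard_doubled: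
  assumes "even (m + u + y + z)" "hadamard (m, u, y, z) = (a, b, c, d)"
  shows "2 * a = m + u + y + z" "2 * b = m + u - y - z"
    "2 * c = m - u + y - z" "2 * d = m - u - y + z"
proof -
  have "even (m + u - y - z)" "even (m - u + y - z)" "even (m - u - y + z)"
    using assms(1) by presburger+
  moreover have "a = (m + u + y + z) div 2" "b = (m + u - y - z) div 2"
    "c = (m - u + y - z) div 2" "d = (m - u - y + z) div 2"
    using assms(2) unfolding hadamard_def by simp_all
  ultimately show "2 * a = m + u + y + z" "2 * b = m + u - y - z"
    "2 * c = m - u + y - z" "2 * d = m - u - y + z"
    using assms(1) by (simp_all only: dvd_mult_div_cancel)
qed

lemma hadamard_involution:
  assumes "even (m + u + y + z)"
  shows "hadamard (hadamard (m, u, y, z)) = (m, u, y, z)"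
proof -
  obtain a b c d where h: "hadamard (m, u, y, z) = (a, b, c, d)" by (metis prod_cases4)
  note d = hadamard_doubled[OF assms h]
  have "a + b + c + d = 2 * m" "a + b - c - d = 2 * u" "a - b + c - d = 2 * y" "a - b - c + d = 2 * z"
    using d by linarith+
  then show ?thesis unfolding h unfolding hadamard_def by simp
qed

lemma hadamard_norm:
  assumes "even (m + u + y + z)" "hadamard (m, u, y, z) = (a, b, c, d)"
  shows "a\<^sup>2 + b\<^sup>2 + c\<^sup>2 + d\<^sup>2 = m\<^sup>2 + u\<^sup>2 + y\<^sup>2 + z\<^sup>2"
proof -
  have "(2 * a)\<^sup>2 + (2 * b)\<^sup>2 + (2 * c)\<^sup>2 + (2 * d)\<^sup>2 = 4 * (m\<^sup>2 + u\<^sup>2 + y\<^sup>2 + z\<^sup>2)"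
    unfolding hadamard_doubled[OF assms] by (simp add: power2_eq_square algebra_simps)
  then show ?thesis by (simp add: power_mult_distrib)
qed

text \<open>\<open>hadamard\<close> permutes the vectors with odd half sum, exchanges
  \<open>m\<close> with the half sum and fixes \<open>m + z\<close>, hence the weight.\<close>

lemma twisted_sum_odd_half_sum:
  "twisted_sum l (\<lambda>m u y z. if odd (half_sum m u y z) then (half_sum m u y z) ^ 3 else 0)
     = twisted_sum l (\<lambda>m u y z. if odd (half_sum m u y z) then m ^ 3 else 0)"
proof -
  let ?S = "{v \<in> ooee_reps l. odd (fst (hadamard v))}"
  have closed: "hadamard v \<in> ?S \<and> hadamard (hadamard v) = v
      \<and> (case v of (m, u, y, z) \<Rightarrow> case hadamard v of (a, b, c, d) \<Rightarrow> a + d = m + z)"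
    if v: "v \<in> ?S" for v
  proof -
    obtain m u y z where [simp]: "v = (m, u, y, z)" by (metis prod_cases4)
    obtain a b c d where h: "hadamard (m, u, y, z) = (a, b, c, d)" by (metis prod_cases4)
    have par: "odd m" "odd u" "even y" "even z" "odd a"
      and norm: "m\<^sup>2 + u\<^sup>2 + y\<^sup>2 + z\<^sup>2 = l"
      using v h by (auto simp: ooee_reps_def)
    then have ev: "even (m + u + y + z)" by simp
    note d = hadamard_doubled[OF ev h]
    \<comment> \<open>The sum of the first row and another row keeps only two entries. Since
      \<open>a\<close> is odd, these identities give the parities of \<open>b\<close>,
      \<open>c\<close>, \<open>d\<close>; the last one also preserves the weight.\<close>
    have "a + b = m + u" "a + c = m + y" "a + d = m + z" using d by linarith+
    then have "odd b" "even c" "even d" using par by presburger+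
    then show ?thesis
      using par norm hadamard_norm[OF ev h] hadamard_involution[OF ev] h \<open>a + d = m + z\<close>
      by (auto simp: ooee_reps_def)
  qed
  have restrict: "twisted_sum l (\<lambda>m u y z. if odd (half_sum m u y z) then f m u y z else 0)
      = (\<Sum>(m, u, y, z)\<in>?S. chi4 (m + z) * f m u y z)" for f
    unfolding twisted_sum_def
    by (rule sum.mono_neutral_cong_right) (auto simp: half_sum_def hadamard_def)
  show ?thesis
    unfolding restrict
  proof (rule sum.reindex_bij_witness[where i = hadamard and j = hadamard])
    fix v assume v: "v \<in> ?S"
    obtain m u y z where [simp]: "v = (m, u, y, z)" by (metis prod_cases4)
    obtain a b c d where h: "hadamard (m, u, y, z) = (a, b, c, d)" by (metis prod_cases4)
    have "a + d = m + z" "a = half_sum m u y z"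
      using closed[OF v] h by (auto simp: half_sum_def hadamard_def)
    then show "(case hadamard v of (m, u, y, z) \<Rightarrow> chi4 (m + z) * m ^ 3)
        = (case v of (m, u, y, z) \<Rightarrow> chi4 (m + z) * (half_sum m u y z) ^ 3)"
      using h by simp
  qed (use closed in blast)+
qed

text \<open>After applying \<open>hadamard\<close> to the terms with even half sum, the sign change of the (even)
  first coordinate preserves the twist, so these terms cancel.\<close>

lemma twisted_sum_even_half_sum:
  "twisted_sum l (\<lambda>m u y z. if even (half_sum m u y z) then (half_sum m u y z) ^ 3 else 0) = 0"
proof -
  let ?S = "{v \<in> ooee_reps l. even (fst (hadamard v))}"
  let ?F = "\<lambda>(m, u, y, z). chi4 (m + z) * (half_sum m u y z) ^ 3"
  \<comment> \<open>The reflection in the hyperplane orthogonal to \<open>(1, 1, 1, 1)\<close>, that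
    is, \<open>hadamard\<close> conjugating the sign change of the first coordinate. It negates the
    half sum \<open>s\<close> and moves \<open>m + z\<close> by \<open>2 * s\<close>, a multiple of
    4 for even \<open>s\<close>.\<close>
  define \<sigma> where "\<sigma> = (\<lambda>(m, u, y, z). (m - half_sum m u y z, u - half_sum m u y z,
    y - half_sum m u y z, z - half_sum m u y z))"
  have step: "\<sigma> v \<in> ?S \<and> \<sigma> (\<sigma> v) = v \<and> ?F (\<sigma> v) = - ?F v" if v: "v \<in> ?S" for v
  proof -
    obtain m u y z where [simp]: "v = (m, u, y, z)" by (metis prod_cases4)
    define s where "s = half_sum m u y z"
    have par: "odd m" "odd u" "even y" "even z" "even s"
      and norm: "m\<^sup>2 + u\<^sup>2 + y\<^sup>2 + z\<^sup>2 = l"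
      using v by (auto simp: ooee_reps_def half_sum_def hadamard_def s_def)
    have s2: "2 * s = m + u + y + z" unfolding s_def using two_half_sum par by blast
    have sig: "\<sigma> v = (m - s, u - s, y - s, z - s)" by (simp add: \<sigma>_def s_def)
    have neg: "half_sum (m - s) (u - s) (y - s) (z - s) = - s"
      using s2 by (simp add: half_sum_def)
    have "(m - s)\<^sup>2 + (u - s)\<^sup>2 + (y - s)\<^sup>2 + (z - s)\<^sup>2
        = m\<^sup>2 + u\<^sup>2 + y\<^sup>2 + z\<^sup>2 + 2 * s * (2 * s - (m + u + y + z))"
      by (simp add: power2_eq_square algebra_simps)
    then have "(m - s)\<^sup>2 + (u - s)\<^sup>2 + (y - s)\<^sup>2 + (z - s)\<^sup>2 = l" using s2 norm by simp
    then have "\<sigma> v \<in> ?S"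
      unfolding sig using par neg by (auto simp: ooee_reps_def hadamard_def half_sum_def)
    moreover have "\<sigma> (\<sigma> v) = v" unfolding sig unfolding \<sigma>_def by (simp add: neg)
    moreover have "chi4 (m - s + (z - s)) = chi4 (m + z)"
      by (rule chi4_cong) (use par in presburger)
    then have "?F (\<sigma> v) = - ?F v" unfolding sig by (simp add: neg s_def[symmetric])
    ultimately show ?thesis by blast
  qed
  have "twisted_sum l (\<lambda>m u y z. if even (half_sum m u y z) then (half_sum m u y z) ^ 3 else 0)
      = sum ?F ?S"
    unfolding twisted_sum_def
    by (rule sum.mono_neutral_cong_right) (auto simp: half_sum_def hadamard_def split: if_splits)
  moreover have "sum ?F ?S = sum (\<lambda>v. - ?F v) ?S"
    by (rule sum.reindex_bij_witness[where i = \<sigma> and j = \<sigma>]) (use step in auto)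
  then have "sum ?F ?S = 0" by (simp add: sum_negf)
  ultimately show ?thesis by simp
qed

text \<open>The twisted sum of \<open>(m + u + y + z) ^ 3\<close> is evaluated twice. Sign averaging
  gives \<open>?C + 3 * ?D\<close>. As 8 times the cube of the half sum, it splits into an odd part,
  worth half of \<open>?C\<close> before the factor 8, and an even part, worth 0. Hence
  \<open>?C + 3 * ?D = 4 * ?C\<close>.\<close>

lemma twisted_sum_harmonic: "twisted_sum l (\<lambda>m u y z. m * (m\<^sup>2 - (u\<^sup>2 + y\<^sup>2 + z\<^sup>2))) = 0"
proof -
  let ?C = "twisted_sum l (\<lambda>m u y z. m ^ 3)"
  let ?D = "twisted_sum l (\<lambda>m u y z. m * (u\<^sup>2 + y\<^sup>2 + z\<^sup>2))"
  let ?h = half_sum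
  have "?C + 3 * ?D = twisted_sum l (\<lambda>m u y z. 8 * ?h m u y z ^ 3)"
    unfolding twisted_sum_cube[symmetric] unfolding twisted_sum_def
    by (rule sum.cong)
      (auto simp: ooee_reps_def two_half_sum[symmetric] power_mult_distrib)
  also have "\<dots> = 8 * twisted_sum l (\<lambda>m u y z. (if odd (?h m u y z) then ?h m u y z ^ 3 else 0)
      + (if even (?h m u y z) then ?h m u y z ^ 3 else 0))"
    unfolding twisted_sum_scale[symmetric]
    by (rule arg_cong[where f = "twisted_sum l"]) (intro ext, simp)
  also have "\<dots> = 4 * (2 * twisted_sum l (\<lambda>m u y z. if odd (?h m u y z) then m ^ 3 else 0))"
    unfolding twisted_sum_add twisted_sum_odd_half_sum twisted_sum_even_half_sum by simp
  also have "\<dots> = 4 * ?C" unfolding twisted_sum_restrict_odd ..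
  finally have "?C = ?D" by simp
  moreover have "twisted_sum l (\<lambda>m u y z. m * (m\<^sup>2 - (u\<^sup>2 + y\<^sup>2 + z\<^sup>2)))
      = twisted_sum l (\<lambda>m u y z. m ^ 3 + (-1) * (m * (u\<^sup>2 + y\<^sup>2 + z\<^sup>2)))"
    by (rule arg_cong[where f = "twisted_sum l"])
      (intro ext, simp add: power2_eq_square power3_eq_cube algebra_simps)
  then have "twisted_sum l (\<lambda>m u y z. m * (m\<^sup>2 - (u\<^sup>2 + y\<^sup>2 + z\<^sup>2))) = ?C + (-1) * ?D"
    by (simp only: twisted_sum_add twisted_sum_scale)
  ultimately show ?thesis by simp
qed

section \<open>The convolution identity and the induction it drives\<close>

text \<open>On the fiber \<open>m\<^sup>2 = k\<close> the harmonic cubic equals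
  \<open>m * (2 * k - l)\<close> and the weight factors by \<open>chi4_add_even\<close>, so each
  fiber yields one term of the convolution.\<close>

lemma convolution_zero: "(\<Sum>k=0..l. root_sum k * oee_sum (l - k) * (2 * k - l)) = 0"
proof -
  let ?F = "\<lambda>(m, u, y, z). chi4 (m + z) * (m * (m\<^sup>2 - (u\<^sup>2 + y\<^sup>2 + z\<^sup>2)))"
  have fiber: "sum ?F {v \<in> ooee_reps l. (fst v)\<^sup>2 = k} = root_sum k * oee_sum (l - k) * (2 * k - l)" for k
  proof -
    have "sum ?F {v \<in> ooee_reps l. (fst v)\<^sup>2 = k}
        = (\<Sum>(m, u, y, z)\<in>odd_roots k \<times> oee_reps (l - k).
            chi4 m * m * (if 4 dvd z then 1 else -1) * (2 * k - l))"
      unfolding ooee_reps_fiber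
    proof (rule sum.cong[OF refl], safe)
      fix m u y z assume "m \<in> odd_roots k" "(u, y, z) \<in> oee_reps (l - k)"
      then have "odd m" "even z" "m\<^sup>2 = k" "u\<^sup>2 + y\<^sup>2 + z\<^sup>2 = l - k"
        by (auto simp: odd_roots_def oee_reps_def)
      then have "m\<^sup>2 - (u\<^sup>2 + y\<^sup>2 + z\<^sup>2) = 2 * k - l" by linarith
      then show "chi4 (m + z) * (m * (m\<^sup>2 - (u\<^sup>2 + y\<^sup>2 + z\<^sup>2)))
          = chi4 m * m * (if 4 dvd z then 1 else -1) * (2 * k - l)"
        using \<open>odd m\<close> \<open>even z\<close> by (simp add: chi4_add_even)
    qed
    also have "\<dots> = root_sum k * oee_sum (l - k) * (2 * k - l)"
    proof -
      have "root_sum k * oee_sum (l - k) = (\<Sum>(m, u, y, z)\<in>odd_roots k \<times> oee_reps (l - k).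
          chi4 m * m * (if 4 dvd z then 1 else -1))"
        unfolding root_sum_def oee_sum_def sum_product sum.cartesian_product
        by (simp add: case_prod_unfold)
      then show ?thesis by (simp add: sum_distrib_right case_prod_unfold)
    qed
    finally show ?thesis .
  qed
  have "(\<Sum>k=0..l. root_sum k * oee_sum (l - k) * (2 * k - l)) = sum ?F (ooee_reps l)"
    unfolding fiber[symmetric] by (rule sum.group[OF _ _ fst_square_ooee_reps]) simp_all
  also have "\<dots> = 0" using twisted_sum_harmonic[of l] unfolding twisted_sum_def .
  finally show ?thesis .
qed


lemma odd_roots_1: "odd_roots 1 = {1, -1}"
  by (auto simp: odd_roots_def power2_eq_1_iff)

lemma oee_reps_1: "oee_reps 1 = {(1, 0, 0), (-1, 0, 0)}"
proof -
  have "(u, y, z) \<in> {(1, 0, 0), (-1, 0, 0)}"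
    if "odd u" and sum: "u\<^sup>2 + y\<^sup>2 + z\<^sup>2 = 1" for u y z :: int
  proof -
    have "u \<noteq> 0" using \<open>odd u\<close> by auto
    then have "u\<^sup>2 > 0" by simp
    moreover have "0 \<le> y\<^sup>2" "0 \<le> z\<^sup>2" by simp_all
    ultimately have "y\<^sup>2 = 0" "z\<^sup>2 = 0" "u\<^sup>2 = 1" using sum by linarith+
    then show ?thesis by (auto simp: power2_eq_1_iff)
  qed
  then show ?thesis by (auto simp: oee_reps_def)
qed

lemma root_sum_0: "root_sum 0 = 0"
proof -
  have "odd_roots 0 = {}" by (auto simp: odd_roots_def)
  then show ?thesis by (simp add: root_sum_def)
qed

lemma oee_sum_0: "oee_sum 0 = 0"
proof -
  have "u = 0" if "u\<^sup>2 + y\<^sup>2 + z\<^sup>2 = 0" for u y z :: int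
    using that by (simp add: add_nonneg_eq_0_iff)
  then have "oee_reps 0 = {}" by (fastforce simp: oee_reps_def)
  then show ?thesis by (simp add: oee_sum_def)
qed

lemma root_sum_1: "root_sum 1 = 2"
  by (simp add: root_sum_def odd_roots_1 chi4_def)

lemma oee_sum_1: "oee_sum 1 = 2"
  by (simp add: oee_sum_def oee_reps_1)

text \<open>In the convolution at \<open>k + 1\<close> the terms other than those at 1 and \<open>k\<close> cancel in pairs
  by the induction hypothesis.\<close>

lemma oee_sum_eq_root_sum: "k \<ge> 0 \<Longrightarrow> oee_sum k = root_sum k"
proof (induction "nat k" arbitrary: k rule: less_induct)
  case less
  consider "k = 0" | "k = 1" | "k \<ge> 2" using less.prems by linarith
  then show ?case
  proof cases
    case 3
    \<comment> \<open>Level \<open>k + 1\<close> pairs the unknown values at \<open>k\<close> with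
      the known value 2 at 1: \<open>f 1 + f k = 2 * (k - 1) * (root_sum k - oee_sum k)\<close>. The
      end terms vanish by \<open>root_sum_0\<close> and \<open>oee_sum_0\<close>.\<close>
    define f where "f j = root_sum j * oee_sum (k + 1 - j) * (2 * j - (k + 1))" for j
    have IH: "oee_sum j = root_sum j" if "0 \<le> j" "j < k" for j
      using less.hyps[of j] that by simp
    have split: "{0..k + 1} = {0, 1, k, k + 1} \<union> {2..k - 1}" using 3 by auto
    have "0 = sum f {0..k + 1}" unfolding f_def using convolution_zero[of "k + 1"] by simp
    also have "\<dots> = f 0 + f 1 + f k + f (k + 1) + sum f {2..k - 1}"
      unfolding split using 3 by (subst sum.union_disjoint) auto
    also have "sum f {2..k - 1} = 0"
    proof -
      \<comment> \<open>The reflection of \<open>j\<close> to \<open>k + 1 - j\<close> negates the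
        linear factor; both indices lie below \<open>k\<close>, so \<open>IH\<close> makes the
        remaining product symmetric.\<close>
      have "sum f {2..k - 1} = (\<Sum>j=2..k - 1. - f j)"
        by (rule sum.reindex_bij_witness[where i = "\<lambda>j. k + 1 - j" and j = "\<lambda>j. k + 1 - j"])
          (auto simp: f_def IH algebra_simps)
      then show ?thesis by (simp add: sum_negf)
    qed
    finally have "(k - 1) * (root_sum k - oee_sum k) = 0"
      by (simp add: f_def root_sum_0 oee_sum_0 root_sum_1 oee_sum_1 algebra_simps)
    then show ?thesis using 3 by simp
  qed (simp_all add: root_sum_0 oee_sum_0 root_sum_1 oee_sum_1)
qed

section \<open>Values of \<open>root_sum\<close>\<close>

text \<open>\<open>chi4\<close> is an odd function, so the roots \<open>m\<close> and
  \<open>-m\<close> contribute equally; for odd \<open>m\<close> the power of -1 is the negative of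
  \<open>chi4 m\<close>.\<close>

lemma root_sum_square:
  fixes m :: nat
  assumes "odd m"
  shows "root_sum ((int m)\<^sup>2) = - 2 * (-1) ^ ((m + 1) div 2) * int m"
proof -
  have roots: "odd_roots ((int m)\<^sup>2) = {int m, - int m}"
    using assms by (auto simp: odd_roots_def power2_eq_iff)
  have "m \<noteq> 0" using assms by (rule contrapos_nn) simp
  have chi: "chi4 (int m) = - ((-1) ^ ((m + 1) div 2)) \<and> chi4 (- int m) = (-1) ^ ((m + 1) div 2)"
  proof (cases "m mod 4 = 1")
    case True
    then have "odd ((m + 1) div 2)" "int m mod 4 = 1" "(- int m) mod 4 = 3" by presburger+
    then show ?thesis by (simp add: chi4_def)
  next
    case False
    then have "even ((m + 1) div 2)" "int m mod 4 = 3" "(- int m) mod 4 = 1"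
      using assms by presburger+
    then show ?thesis by (simp add: chi4_def)
  qed
  show ?thesis
    unfolding root_sum_def roots using \<open>m \<noteq> 0\<close> chi by simp
qed

lemma root_sum_nonsquare:
  assumes "\<nexists>m::nat. m > 0 \<and> k = m\<^sup>2"
  shows "root_sum (int k) = 0"
proof -
  have False if "odd x" "x\<^sup>2 = int k" for x
  proof -
    have "int ((nat \<bar>x\<bar>)\<^sup>2) = int k" using that by simp
    then have "k = (nat \<bar>x\<bar>)\<^sup>2" by linarith
    moreover have "nat \<bar>x\<bar> > 0" using \<open>odd x\<close> by (cases "x = 0") auto
    ultimately show False using assms by blast
  qed
  then have "odd_roots (int k) = {}" by (auto simp: odd_roots_def)
  then show ?thesis by (simp add: root_sum_def)
qed

section \<open>From coefficient lists to triples\<close>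

lemma card_lists_length_3:
  "card {xs :: 'a list. length xs = 3 \<and> P (xs ! 0) (xs ! 1) (xs ! 2)} = card {(x, y, z). P x y z}"
proof (rule bij_betw_same_card)
  show "bij_betw (\<lambda>xs. (xs ! 0, xs ! 1, xs ! 2))
      {xs. length xs = 3 \<and> P (xs ! 0) (xs ! 1) (xs ! 2)} {(x, y, z). P x y z}"
    by (rule bij_betw_byWitness[where f' = "\<lambda>(x, y, z). [x, y, z]"])
      (auto simp: numeral_3_eq_3 length_Suc_conv)
qed

lemma r3_eq_card: "r3 n = card {(x, y, z). x\<^sup>2 + y\<^sup>2 + z\<^sup>2 = int n}"
proof -
  have "r3 n = card {xs :: int list. length xs = 3 \<and> (xs ! 0)\<^sup>2 + (xs ! 1)\<^sup>2 + (xs ! 2)\<^sup>2 = int n}"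
    unfolding r3_def N_rep_def
    by (rule arg_cong[where f = card]) (auto simp: numeral_3_eq_3 numeral_2_eq_2)
  also have "\<dots> = card {(x, y, z). x\<^sup>2 + y\<^sup>2 + z\<^sup>2 = int n}"
    by (rule card_lists_length_3)
  finally show ?thesis .
qed

lemma N_rep_118_eq_card: "N_rep [1, 1, 8] n = card {(x, y, z). x\<^sup>2 + y\<^sup>2 + 8 * z\<^sup>2 = int n}"
proof -
  have "N_rep [1, 1, 8] n
      = card {xs :: int list. length xs = 3 \<and> (xs ! 0)\<^sup>2 + (xs ! 1)\<^sup>2 + 8 * (xs ! 2)\<^sup>2 = int n}"
    unfolding N_rep_def
    by (rule arg_cong[where f = card]) (auto simp: numeral_3_eq_3 numeral_2_eq_2)
  also have "\<dots> = card {(x, y, z). x\<^sup>2 + y\<^sup>2 + 8 * z\<^sup>2 = int n}"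
    by (rule card_lists_length_3)
  finally show ?thesis .
qed

lemma t_rep_118_eq_card:
  "t_rep [1, 1, 8] n
     = card {(x, y, z). (2 * x - 1)\<^sup>2 + (2 * y - 1)\<^sup>2 + 8 * (2 * z - 1)\<^sup>2 = 8 * int n + 10}"
proof -
  \<comment> \<open>Completing the square in 8 times a triangular number costs 1; with coefficients
    1, 1, 8 the total cost is the constant 10.\<close>
  have tri: "8 * (x * (x - 1) div 2) = (2 * x - 1)\<^sup>2 - 1" for x :: int
  proof -
    have "2 * (x * (x - 1) div 2) = x * (x - 1)" by simp
    then have "8 * (x * (x - 1) div 2) = 4 * (x * (x - 1))" by linarith
    then show ?thesis by (simp only: power2_eq_square) (simp add: algebra_simps)
  qed
  have eq: "int n = x * (x - 1) div 2 + y * (y - 1) div 2 + 8 * (z * (z - 1) div 2)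
      \<longleftrightarrow> (2 * x - 1)\<^sup>2 + (2 * y - 1)\<^sup>2 + 8 * (2 * z - 1)\<^sup>2 = 8 * int n + 10" for x y z :: int
    using tri[of x] tri[of y] tri[of z] by linarith
  have "t_rep [1, 1, 8] n = card {xs :: int list. length xs = 3 \<and>
      int n = xs ! 0 * (xs ! 0 - 1) div 2 + xs ! 1 * (xs ! 1 - 1) div 2
        + 8 * (xs ! 2 * (xs ! 2 - 1) div 2)}"
    unfolding t_rep_def
    by (rule arg_cong[where f = card]) (auto simp: numeral_3_eq_3 numeral_2_eq_2)
  also have "\<dots> = card {(x, y, z). int n = x * (x - 1) div 2 + y * (y - 1) div 2 + 8 * (z * (z - 1) div 2)}"
    by (rule card_lists_length_3)
  finally show ?thesis unfolding eq .
qed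

section \<open>Parity of three squares and counts in terms of \<open>oee_reps\<close>\<close>

lemma square_mod_4: "(x::int)\<^sup>2 mod 4 = (if even x then 0 else 1)"
proof (cases "even x")
  case True
  then obtain a where "x = 2 * a" by blast
  then show ?thesis by (simp add: power2_eq_square)
next
  case False
  then obtain a where "x = 2 * a + 1" by (rule oddE)
  then have "x\<^sup>2 = 1 + 4 * (a\<^sup>2 + a)" by (simp add: power2_eq_square algebra_simps)
  then have "x\<^sup>2 mod 4 = 1" by presburger
  then show ?thesis using False by simp
qed

text \<open>Modulo 4 the sum counts the odd entries among the three.\<close>

lemma three_squares_parity:
  fixes u v w :: int
  assumes "(u\<^sup>2 + v\<^sup>2 + w\<^sup>2) mod 4 = 1"
  shows "odd u \<and> even v \<and> even w \<or> even u \<and> odd v \<and> even w \<or> even u \<and> even v \<and> odd w"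
proof -
  have "(u\<^sup>2 mod 4 + v\<^sup>2 mod 4 + w\<^sup>2 mod 4) mod 4 = 1" using assms by presburger
  then show ?thesis unfolding square_mod_4 by (auto split: if_splits)
qed

text \<open>The factor 3 is the choice of the position of the unique odd coordinate;
  \<open>?p\<close> and \<open>?q\<close> move it from first to second or third place.\<close>

lemma card_three_squares:
  assumes "k mod 4 = 1"
  shows "card {(u, v, w). u\<^sup>2 + v\<^sup>2 + w\<^sup>2 = k} = 3 * card (oee_reps k)"
proof -
  let ?E = "oee_reps k"
  let ?p = "\<lambda>(u, v, w). (v, u, w) :: int \<times> int \<times> int"
  let ?q = "\<lambda>(u, v, w). (w, v, u) :: int \<times> int \<times> int"
  have "{(u, v, w). u\<^sup>2 + v\<^sup>2 + w\<^sup>2 = k} = ?E \<union> ?p ` ?E \<union> ?q ` ?E" (is "?A = ?B")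
  proof
    show "?A \<subseteq> ?B"
    proof safe
      fix u v w :: int
      assume k: "k = u\<^sup>2 + v\<^sup>2 + w\<^sup>2" and nq: "(u, v, w) \<notin> ?q ` oee_reps (u\<^sup>2 + v\<^sup>2 + w\<^sup>2)"
        and np: "(u, v, w) \<notin> ?p ` oee_reps (u\<^sup>2 + v\<^sup>2 + w\<^sup>2)"
      have "(w, v, u) \<notin> oee_reps (u\<^sup>2 + v\<^sup>2 + w\<^sup>2)" "(v, u, w) \<notin> oee_reps (u\<^sup>2 + v\<^sup>2 + w\<^sup>2)"
        using nq np by force+
      then show "(u, v, w) \<in> oee_reps (u\<^sup>2 + v\<^sup>2 + w\<^sup>2)"
        using three_squares_parity[of u v w] assms k by (auto simp: oee_reps_def)
    qed
  qed (auto simp: oee_reps_def)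
  moreover have "card (?p ` ?E) = card ?E" "card (?q ` ?E) = card ?E"
    by (auto intro!: card_image inj_onI)
  moreover have "?E \<inter> ?p ` ?E = {}" "(?E \<union> ?p ` ?E) \<inter> ?q ` ?E = {}"
    by (auto simp: oee_reps_def)
  ultimately show ?thesis by (simp add: card_Un_disjoint)
qed

text \<open>An even last coordinate leaves two positions for the odd one. \<open>P\<close> will be
  \<open>even\<close> for \<open>N_rep\<close> and \<open>w mod 4 = 2\<close> for
  \<open>t_rep\<close>.\<close>

lemma card_three_squares_last_even:
  assumes "k mod 4 = 1" and P: "\<And>w. P w \<Longrightarrow> even w"
  shows "card {(u, v, w). P w \<and> u\<^sup>2 + v\<^sup>2 + w\<^sup>2 = k} = 2 * card {(u, v, w) \<in> oee_reps k. P w}"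
proof -
  let ?E = "{(u, v, w) \<in> oee_reps k. P w}"
  let ?p = "\<lambda>(u, v, w). (v, u, w) :: int \<times> int \<times> int"
  have "{(u, v, w). P w \<and> u\<^sup>2 + v\<^sup>2 + w\<^sup>2 = k} = ?E \<union> ?p ` ?E" (is "?A = ?B")
  proof
    show "?A \<subseteq> ?B"
    proof
      fix t assume "t \<in> ?A"
      then obtain u v w where t: "t = (u, v, w)" and "P w" and k: "u\<^sup>2 + v\<^sup>2 + w\<^sup>2 = k" by auto
      then have "(u, v, w) \<in> ?E \<or> (v, u, w) \<in> ?E"
        using three_squares_parity[of u v w] assms(1) P[of w] by (auto simp: oee_reps_def)
      then show "t \<in> ?B" unfolding t by force
    qed
  qed (auto simp: oee_reps_def)
  moreover have "card (?p ` ?E) = card ?E"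
    by (auto intro!: card_image inj_onI)
  moreover have "?E \<inter> ?p ` ?E = {}"
    by (auto simp: oee_reps_def)
  moreover have "finite ?E" by (rule finite_subset[OF _ finite_oee_reps[of k]]) auto
  ultimately show ?thesis by (simp add: card_Un_disjoint)
qed

lemma sum_diff_squares: "(u + v)\<^sup>2 + (u - v)\<^sup>2 = 2 * (u\<^sup>2 + v\<^sup>2)" for u v :: int
  by (simp add: power2_eq_square algebra_simps)

text \<open>\<open>x\<close> and \<open>y\<close> have equal parity, so
  \<open>u = (x + y) / 2\<close>, \<open>v = (x - y) / 2\<close> is an integral change of variables
  that halves the sum of two squares; \<open>w = 2 * z\<close> absorbs the coefficient 8.\<close>

lemma card_118_reps:
  fixes k :: int
  shows "card {(x, y, z). x\<^sup>2 + y\<^sup>2 + 8 * z\<^sup>2 = 2 * k} = card {(u, v, w). even w \<and> u\<^sup>2 + v\<^sup>2 + w\<^sup>2 = k}"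
proof (rule bij_betw_same_card)
  show "bij_betw (\<lambda>(x, y, z). ((x + y) div 2, (x - y) div 2, 2 * z))
      {(x, y, z). x\<^sup>2 + y\<^sup>2 + 8 * z\<^sup>2 = 2 * k} {(u, v, w). even w \<and> u\<^sup>2 + v\<^sup>2 + w\<^sup>2 = k}"
  proof (rule bij_betw_byWitness[where f' = "\<lambda>(u, v, w). (u + v, u - v, w div 2)"])
    have *: "\<exists>u v. x = u + v \<and> y = u - v \<and> u\<^sup>2 + v\<^sup>2 + (2 * z)\<^sup>2 = k"
      if "x\<^sup>2 + y\<^sup>2 + 8 * z\<^sup>2 = 2 * k" for x y z :: int
    proof -
      have "even (x\<^sup>2 + y\<^sup>2 + 8 * z\<^sup>2)" unfolding that by simp
      then have "even (x + y)" by simp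
      then obtain u where u: "x + y = 2 * u" by blast
      then have "x = u + (x - u)" "y = u - (x - u)" by auto
      moreover have "u\<^sup>2 + (x - u)\<^sup>2 + (2 * z)\<^sup>2 = k"
        using that sum_diff_squares[of u "x - u"] calculation by (simp add: power_mult_distrib)
      ultimately show ?thesis by blast
    qed
    show "\<forall>t\<in>{(x, y, z). x\<^sup>2 + y\<^sup>2 + 8 * z\<^sup>2 = 2 * k}.
        (case case t of (x, y, z) \<Rightarrow> ((x + y) div 2, (x - y) div 2, 2 * z) of
          (u, v, w) \<Rightarrow> (u + v, u - v, w div 2)) = t"
      by (auto dest!: *)
    show "(\<lambda>(x, y, z). ((x + y) div 2, (x - y) div 2, 2 * z)) ` {(x, y, z). x\<^sup>2 + y\<^sup>2 + 8 * z\<^sup>2 = 2 * k}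
        \<subseteq> {(u, v, w). even w \<and> u\<^sup>2 + v\<^sup>2 + w\<^sup>2 = k}"
      by (auto dest!: *)
    show "(\<lambda>(u, v, w). (u + v, u - v, w div 2)) ` {(u, v, w). even w \<and> u\<^sup>2 + v\<^sup>2 + w\<^sup>2 = k}
        \<subseteq> {(x, y, z). x\<^sup>2 + y\<^sup>2 + 8 * z\<^sup>2 = 2 * k}"
      by (auto simp: sum_diff_squares power_mult_distrib elim!: evenE)
  qed auto
qed

text \<open>The substitution of \<open>card_118_reps\<close> applied to \<open>2 * x - 1\<close>,
  \<open>2 * y - 1\<close>, \<open>2 * z - 1\<close>; oddness of the last becomes
  \<open>w mod 4 = 2\<close>.\<close>

lemma card_118_odd_reps:
  fixes k :: int
  assumes "k mod 4 = 1"
  shows "card {(x, y, z). (2 * x - 1)\<^sup>2 + (2 * y - 1)\<^sup>2 + 8 * (2 * z - 1)\<^sup>2 = 2 * k}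
     = card {(u, v, w). w mod 4 = 2 \<and> u\<^sup>2 + v\<^sup>2 + w\<^sup>2 = k}"
proof (rule bij_betw_same_card)
  let ?X = "{(x, y, z). (2 * x - 1)\<^sup>2 + (2 * y - 1)\<^sup>2 + 8 * (2 * z - 1)\<^sup>2 = 2 * k}"
  let ?U = "{(u, v, w). w mod 4 = 2 \<and> u\<^sup>2 + v\<^sup>2 + w\<^sup>2 = k}"
  show "bij_betw (\<lambda>(x, y, z). (x + y - 1, x - y, 4 * z - 2)) ?X ?U"
  proof (rule bij_betw_byWitness[where
        f' = "\<lambda>(u, v, w). ((u + v + 1) div 2, (u - v + 1) div 2, (w + 2) div 4)"])
    show "(\<lambda>(x, y, z). (x + y - 1, x - y, 4 * z - 2)) ` ?X \<subseteq> ?U"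
    proof safe
      fix x y z :: int
      assume h: "(2 * x - 1)\<^sup>2 + (2 * y - 1)\<^sup>2 + 8 * (2 * z - 1)\<^sup>2 = 2 * k"
      show "(4 * z - 2) mod 4 = 2" by presburger
      show "(x + y - 1)\<^sup>2 + (x - y)\<^sup>2 + (4 * z - 2)\<^sup>2 = k"
        using h by (simp add: power2_eq_square algebra_simps)
    qed
    have *: "\<exists>x y z. u = x + y - 1 \<and> v = x - y \<and> w = 4 * z - 2
        \<and> (2 * x - 1)\<^sup>2 + (2 * y - 1)\<^sup>2 + 8 * (2 * z - 1)\<^sup>2 = 2 * k"
      if w: "w mod 4 = 2" and h: "u\<^sup>2 + v\<^sup>2 + w\<^sup>2 = k" for u v w :: int
    proof -
      have "even w" using w by presburger
      \<comment> \<open>Exactly one coordinate is odd and it is not \<open>w\<close>; this parity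
        makes the inverse substitution integral.\<close>
      then have "odd (u + v)" using three_squares_parity[of u v w] h assms by auto
      then obtain a where a: "u + v = 2 * a + 1" by (rule oddE)
      have "\<exists>z. w = 4 * z - 2" using w by presburger
      then obtain z where z: "w = 4 * z - 2" ..
      define x y where "x = a + 1" and "y = a + 1 - v"
      have uv: "u = x + y - 1" "v = x - y" using a by (auto simp: x_def y_def)
      have "(2 * x - 1)\<^sup>2 + (2 * y - 1)\<^sup>2 + 8 * (2 * z - 1)\<^sup>2 = 2 * k"
        using h unfolding uv z by (simp add: power2_eq_square algebra_simps)
      then show ?thesis using uv z by blast
    qed
    show "\<forall>t\<in>?U. (case case t of (u, v, w) \<Rightarrow> ((u + v + 1) div 2, (u - v + 1) div 2, (w + 2) div 4) of
        (x, y, z) \<Rightarrow> (x + y - 1, x - y, 4 * z - 2)) = t"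
      by (auto dest!: *)
    show "(\<lambda>(u, v, w). ((u + v + 1) div 2, (u - v + 1) div 2, (w + 2) div 4)) ` ?U \<subseteq> ?X"
      by (auto dest!: *)
  qed auto
qed

text \<open>For even \<open>w\<close> the sign is -1 exactly when \<open>w mod 4 = 2\<close>, so the
  signed sum is the full count minus twice the count of such vectors.\<close>

lemma oee_sum_eq_card:
  "oee_sum k = int (card (oee_reps k)) - 2 * int (card {(u, v, w) \<in> oee_reps k. w mod 4 = 2})"
proof -
  have "oee_sum k = (\<Sum>t\<in>oee_reps k. 1 - 2 * of_bool (case t of (u, v, w) \<Rightarrow> w mod 4 = 2))"
    unfolding oee_sum_def
  proof (rule sum.cong[OF refl], safe)
    fix u v w assume "(u, v, w) \<in> oee_reps k"
    then have "4 dvd w \<longleftrightarrow> w mod 4 \<noteq> 2" unfolding oee_reps_def by simp presburger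
    then show "(if 4 dvd w then 1 else - 1) = 1 - 2 * (of_bool (w mod 4 = 2) :: int)" by simp
  qed
  also have "\<dots> = int (card (oee_reps k))
      - 2 * int (card (oee_reps k \<inter> {t. case t of (u, v, w) \<Rightarrow> w mod 4 = 2}))"
    by (simp add: sum_subtractf sum_distrib_left[symmetric] of_bool_def sum.If_cases)
  also have "oee_reps k \<inter> {t. case t of (u, v, w) \<Rightarrow> w mod 4 = 2}
      = {(u, v, w) \<in> oee_reps k. w mod 4 = 2}" by auto
  finally show ?thesis .
qed

theorem theorem2p1:
  fixes n :: nat
  assumes "n > 0"
  shows "real (t_rep [1, 1, 8] n) - 1 / 2 * real (N_rep [1, 1, 8] (8 * n + 10))
           = real (t_rep [1, 1, 8] n) - 1 / 3 * real (r3 (4 * n + 5))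
       \<and> (\<forall>m::nat. m > 0 \<and> 4 * n + 5 = m\<^sup>2 \<longrightarrow>
             real (t_rep [1, 1, 8] n) - 1 / 3 * real (r3 (4 * n + 5))
               = 2 * (-1) ^ ((m + 1) div 2) * real m)
       \<and> ((\<nexists>m::nat. m > 0 \<and> 4 * n + 5 = m\<^sup>2) \<longrightarrow>
             real (t_rep [1, 1, 8] n) - 1 / 3 * real (r3 (4 * n + 5)) = 0)"
proof -
  define k where "k = int (4 * n + 5)"
  \<comment> \<open>All three counts reduce to \<open>E\<close> and \<open>D\<close>:
    \<open>r3\<close> is \<open>3 * E\<close>, \<open>N_rep\<close> is \<open>2 * E\<close>,
    \<open>t_rep\<close> is \<open>2 * D\<close>. The difference is therefore
    \<open>2 * D - E\<close>, the negative of \<open>oee_sum k\<close>.\<close>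
  define E where "E = card (oee_reps k)"
  define D where "D = card {(u, v, w) \<in> oee_reps k. w mod 4 = 2}"
  have k: "k mod 4 = 1" "k \<ge> 0" unfolding k_def by presburger+
  have two_k: "int (8 * n + 10) = 2 * k" "8 * int n + 10 = 2 * k" unfolding k_def by simp_all
  have r3: "r3 (4 * n + 5) = 3 * E"
    unfolding r3_eq_card E_def k_def[symmetric] by (rule card_three_squares[OF k(1)])
  have "{(u, v, w) \<in> oee_reps k. even w} = oee_reps k" by (auto simp: oee_reps_def)
  then have N: "N_rep [1, 1, 8] (8 * n + 10) = 2 * E"
    unfolding N_rep_118_eq_card two_k card_118_reps E_def
    using card_three_squares_last_even[OF k(1), of even] by simp
  have "even w" if "w mod 4 = 2" for w :: int using that by presburger
  then have t: "t_rep [1, 1, 8] n = 2 * D"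
    unfolding t_rep_118_eq_card two_k card_118_odd_reps[OF k(1)] D_def
    by (intro card_three_squares_last_even[OF k(1)])
  have "2 * int D - int E = - root_sum k"
    using oee_sum_eq_card[of k] oee_sum_eq_root_sum[OF k(2)] unfolding D_def E_def by simp
  then have "real_of_int (2 * int D - int E) = real_of_int (- root_sum k)" by (rule arg_cong)
  then have main: "real (t_rep [1, 1, 8] n) - 1 / 3 * real (r3 (4 * n + 5)) = - real_of_int (root_sum k)"
    unfolding r3 t by simp
  have "real_of_int (root_sum k) = - 2 * (-1) ^ ((m + 1) div 2) * real m"
    if "4 * n + 5 = m\<^sup>2" for m :: nat
  proof -
    have "odd (m\<^sup>2)" unfolding that[symmetric] by simp
    then have "odd m" by simp
    have "k = (int m)\<^sup>2" unfolding k_def that by simp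
    then show ?thesis using root_sum_square[OF \<open>odd m\<close>] by simp
  qed
  moreover have "root_sum k = 0" if "\<nexists>m::nat. m > 0 \<and> 4 * n + 5 = m\<^sup>2"
    unfolding k_def using that by (rule root_sum_nonsquare)
  moreover have half: "1 / 2 * real (N_rep [1, 1, 8] (8 * n + 10)) = 1 / 3 * real (r3 (4 * n + 5))"
    unfolding N r3 by simp
  ultimately show ?thesis unfolding half main by simp
qed

end
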